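(* Let $(X,r)$ be a non-degenerate involutive set-theoretic solution to the Yang--Baxter equation, with $r(x,y)=(\sigma_x(y),\tau_y(x))$, and let $k\colon X\to X$ be a map. For $x,y\in X$ put $t(x,y)=\sigma_{\sigma_x(y)}\bigl(k(\tau_y(x))\bigr)$. Then $k$ is a reflection of $(X,r)$ if and only if $$t(x,y)=t(x,k(y))$$ for all $x,y\in X$.
   Context: A set-theoretic solution to the Yang--Baxter equation (YBE) is a pair $(X,r)$, where $X$ is a set and $r\colon X\times X\to X\times X$ is a bijective map with $(r\times\mathrm{id})(\mathrm{id}\times r)(r\times\mathrm{id})=(\mathrm{id}\times r)(r\times\mathrm{id})(\mathrm{id}\times r)$ on $X\times X\times X$. Write $r(x,y)=(\sigma_x(y),\tau_y(x))$. The solution is non-degenerate if all maps $\sigma_x,\tau_x\colon X\to X$ ($x\in X$) are bijective, and involutive if $r^2=\mathrm{id}_{X\times X}$. For a non-degenerate solution $(X,r)$, a map $k\colon X\to X$ (not assumed bijective) is a reflection of $(X,r)$ if $r(\mathrm{id}\times k)r(\mathrm{id}\times k)=(\mathrm{id}\times k)r(\mathrm{id}\times k)r$ as maps $X\times X\to X\times X$. *)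

theory Defs
  imports Main "HOL-Library.FuncSet"
begin

text \<open>
  The underlying set of a solution is a carrier \<open>X\<close>, possibly empty; all maps are total functions
  on the ambient type, and only their values on \<open>X\<close>, \<open>X \<times> X\<close> and \<open>X \<times> X \<times> X\<close> matter.
\<close>

text \<open>The argument order is chosen such that \<open>r (x, y) = (sigma r x y, tau r y x)\<close>.\<close>

definition sigma :: "('a \<times> 'a \<Rightarrow> 'a \<times> 'a) \<Rightarrow> 'a \<Rightarrow> 'a \<Rightarrow> 'a" where
  "sigma r x y = fst (r (x, y))"

definition tau :: "('a \<times> 'a \<Rightarrow> 'a \<times> 'a) \<Rightarrow> 'a \<Rightarrow> 'a \<Rightarrow> 'a" where
  "tau r y x = snd (r (x, y))"

text \<open>
  \<open>r \<times> id\<close> and \<open>id \<times> r\<close> on triples. Triples nest to the right, so the first one has to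
  reassociate.
\<close>

definition r12 :: "('a \<times> 'a \<Rightarrow> 'a \<times> 'a) \<Rightarrow> 'a \<times> 'a \<times> 'a \<Rightarrow> 'a \<times> 'a \<times> 'a" where
  "r12 r = (\<lambda>(x, y, z). (fst (r (x, y)), snd (r (x, y)), z))"

definition r23 :: "('a \<times> 'a \<Rightarrow> 'a \<times> 'a) \<Rightarrow> 'a \<times> 'a \<times> 'a \<Rightarrow> 'a \<times> 'a \<times> 'a" where
  "r23 r = map_prod id r"

definition ybe_solution :: "'a set \<Rightarrow> ('a \<times> 'a \<Rightarrow> 'a \<times> 'a) \<Rightarrow> bool" where
  "ybe_solution X r \<longleftrightarrow>
     bij_betw r (X \<times> X) (X \<times> X) \<and>
     (\<forall>p \<in> X \<times> X \<times> X. (r12 r \<circ> r23 r \<circ> r12 r) p = (r23 r \<circ> r12 r \<circ> r23 r) p)"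

definition nondegenerate :: "'a set \<Rightarrow> ('a \<times> 'a \<Rightarrow> 'a \<times> 'a) \<Rightarrow> bool" where
  "nondegenerate X r \<longleftrightarrow>
     (\<forall>x \<in> X. bij_betw (sigma r x) X X \<and> bij_betw (tau r x) X X)"

definition involutive :: "'a set \<Rightarrow> ('a \<times> 'a \<Rightarrow> 'a \<times> 'a) \<Rightarrow> bool" where
  "involutive X r \<longleftrightarrow> (\<forall>p \<in> X \<times> X. (r \<circ> r) p = p)"

definition reflection :: "'a set \<Rightarrow> ('a \<times> 'a \<Rightarrow> 'a \<times> 'a) \<Rightarrow> ('a \<Rightarrow> 'a) \<Rightarrow> bool" where
  "reflection X r k \<longleftrightarrow>
     k \<in> X \<rightarrow> X \<and>
     (\<forall>p \<in> X \<times> X. (r \<circ> map_prod id k \<circ> r \<circ> map_prod id k) p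
                 = (map_prod id k \<circ> r \<circ> map_prod id k \<circ> r) p)"

definition t_map :: "('a \<times> 'a \<Rightarrow> 'a \<times> 'a) \<Rightarrow> ('a \<Rightarrow> 'a) \<Rightarrow> 'a \<Rightarrow> 'a \<Rightarrow> 'a" where
  "t_map r k x y = sigma r (sigma r x y) (k (tau r y x))"

end

theory Submission
  imports Defs
begin

text \<open>
  The first component of the reflection equation at \<open>(x, y)\<close> is exactly \<open>t(x, y) = t(x, k y)\<close>.
  For the second one, let \<open>(u, v) = r(x, y)\<close>, \<open>(t, z) = r(u, k v)\<close> and \<open>(t, z') = r(u', k v')\<close>,
  where \<open>(u', v') = r(x, k y)\<close>; one has to show \<open>z' = k z\<close>. By involutivity \<open>r(u, v) = (x, y)\<close>,
  so the hypothesis at \<open>(u, v)\<close> reads \<open>\<sigma>\<^sub>x(k y) = \<sigma>\<^sub>t(k z)\<close>. Again by involutivity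
  \<open>\<sigma>\<^sub>t(z') = u' = \<sigma>\<^sub>x(k y)\<close>, and \<open>\<sigma>\<^sub>t\<close> is injective.
\<close>

lemma r_eq_sigma_tau: "r (x, y) = (sigma r x y, tau r y x)"
  by (simp add: sigma_def tau_def)

text \<open>Compare components at \<open>(x, y)\<close>: the forward direction of the theorem is
  then a projection, and the converse owes only the second equation.\<close>

lemma reflection_iff:
  "reflection X r k \<longleftrightarrow> k \<in> X \<rightarrow> X \<and>
    (\<forall>x \<in> X. \<forall>y \<in> X. t_map r k x (k y) = t_map r k x y \<and>
       tau r (k (tau r (k y) x)) (sigma r x (k y)) = k (tau r (k (tau r y x)) (sigma r x y)))"
  by (simp add: reflection_def t_map_def r_eq_sigma_tau[of r])

lemma sigma_tau_closed:
  assumes "nondegenerate X r" "x \<in> X" "y \<in> X"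
  shows "sigma r x y \<in> X" "tau r y x \<in> X"
  using assms by (auto simp: nondegenerate_def dest: bij_betwE)

lemma involutive_sigma_tau:
  assumes "involutive X r" "x \<in> X" "y \<in> X"
  shows "sigma r (sigma r x y) (tau r y x) = x"
    and "tau r (tau r y x) (sigma r x y) = y"
proof -
  have "r (r (x, y)) = (x, y)"
    using assms by (simp add: involutive_def)
  then show "sigma r (sigma r x y) (tau r y x) = x" "tau r (tau r y x) (sigma r x y) = y"
    by (simp_all add: r_eq_sigma_tau[of r])
qed

theorem theorem1p8:
  fixes X :: "'a set"
    and r :: "'a \<times> 'a \<Rightarrow> 'a \<times> 'a"
    and k :: "'a \<Rightarrow> 'a"
  assumes "ybe_solution X r"
    and "nondegenerate X r"
    and "involutive X r"
    and "k \<in> X \<rightarrow> X"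
  shows "reflection X r k \<longleftrightarrow> (\<forall>x \<in> X. \<forall>y \<in> X. t_map r k x y = t_map r k x (k y))"
proof
  assume "reflection X r k"
  then show "\<forall>x \<in> X. \<forall>y \<in> X. t_map r k x y = t_map r k x (k y)"
    by (simp add: reflection_iff)
next
  assume t_eq: "\<forall>x \<in> X. \<forall>y \<in> X. t_map r k x y = t_map r k x (k y)"
  note closed = sigma_tau_closed[OF assms(2)]
  note inv = involutive_sigma_tau[OF assms(3)]
  have k: "k a \<in> X" if "a \<in> X" for a
    using assms(4) that by blast
  have "tau r (k (tau r (k y) x)) (sigma r x (k y)) = k (tau r (k (tau r y x)) (sigma r x y))"
    if x: "x \<in> X" and y: "y \<in> X" for x y
  proof -
    define u v where "u = sigma r x y" and "v = tau r y x"
    define u' v' where "u' = sigma r x (k y)" and "v' = tau r (k y) x"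
    define t z z' where "t = sigma r u (k v)" and "z = tau r (k v) u" and "z' = tau r (k v') u'"
    have uv: "u \<in> X" "v \<in> X" "u' \<in> X" "v' \<in> X"
      by (simp_all add: u_def v_def u'_def v'_def closed k x y)
    have tz: "t \<in> X" "z \<in> X" "z' \<in> X"
      by (simp_all add: t_def z_def z'_def closed k uv)
    \<comment> \<open>The hypothesis at \<open>(x, y)\<close> gives
      \<open>r (u', k v') = (t, z')\<close> with the same \<open>t\<close>.\<close>
    have t': "sigma r u' (k v') = t"
      using t_eq x y by (simp add: t_map_def t_def u_def v_def u'_def v'_def)
    have "sigma r t z' = u'"
      using inv(1)[of u' "k v'"] uv k by (simp add: t' z'_def)
    \<comment> \<open>Involutivity turns \<open>(u, v)\<close> back into \<open>(x, y)\<close>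
      inside \<open>t_map\<close>.\<close>
    also have "u' = t_map r k u v"
      by (simp add: t_map_def u'_def u_def v_def inv x y)
    \<comment> \<open>Second use of the hypothesis, now at \<open>(u, v)\<close>.\<close>
    also have "\<dots> = t_map r k u (k v)"
      using t_eq uv by blast
    also have "\<dots> = sigma r t (k z)"
      by (simp add: t_map_def t_def z_def)
    finally have "sigma r t z' = sigma r t (k z)" .
    moreover have "inj_on (sigma r t) X"
      using assms(2) tz by (auto simp: nondegenerate_def bij_betw_def)
    ultimately have "z' = k z"
      using tz k by (blast dest: inj_onD)
    then show ?thesis
      by (simp add: z'_def z_def u_def v_def u'_def v'_def)
  qed
  then show "reflection X r k"
    using assms(4) t_eq by (simp add: reflection_iff)
qed

end
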